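(* Let $n\ge 1$ and let the edges of the complete graph $K_n$ be colored arbitrarily with two colors, red and blue. Then there is a monochromatic diameter two subgraph $H$ of $K_n$ with $|V(H)|\ge \lceil 3n/4\rceil$. Moreover, there exist red/blue colorings of the edges of $K_n$ for which the largest monochromatic diameter two subgraph has exactly $\lceil 3n/4\rceil$ vertices.
   Context: A subgraph $H$ of an edge-colored complete graph is monochromatic if all edges of $H$ have the same color. A graph $H$ has diameter two (is a diameter two subgraph) if for every pair of vertices $x,y$ of $H$ there is a path in $H$ joining $x$ and $y$ containing at most two edges. The size of a subgraph is its number of vertices. *)

theory Defs
  imports Complex_Main "HOL-Library.Ramsey"
begin

record 'a ugraph =
  verts :: "'a set"
  edges :: "'a set set"

text \<open>\<open>[X]\<^bsup>2\<^esup>\<close> is the set of two-element subsets of \<open>X\<close>, so these are simple undirected graphs.\<close>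

definition simple_graph :: "'a ugraph \<Rightarrow> bool" where
  "simple_graph G \<longleftrightarrow> edges G \<subseteq> [verts G]\<^bsup>2\<^esup>"

definition complete_graph :: "nat \<Rightarrow> nat ugraph" where
  "complete_graph n = \<lparr>verts = {..<n}, edges = [{..<n}]\<^bsup>2\<^esup>\<rparr>"

text \<open>Subgraphs need not be induced.\<close>

definition subgraph :: "'a ugraph \<Rightarrow> 'a ugraph \<Rightarrow> bool" where
  "subgraph H G \<longleftrightarrow> simple_graph H \<and> verts H \<subseteq> verts G \<and> edges H \<subseteq> edges G"

text \<open>A path is represented by its nonempty list of vertices, so it has \<open>length p - 1\<close> edges.\<close>

definition path_between :: "'a ugraph \<Rightarrow> 'a \<Rightarrow> 'a list \<Rightarrow> 'a \<Rightarrow> bool" where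
  "path_between G x p y \<longleftrightarrow>
     p \<noteq> [] \<and> hd p = x \<and> last p = y \<and> distinct p \<and> set p \<subseteq> verts G \<and>
     successively (\<lambda>u v. {u, v} \<in> edges G) p"

definition diameter_two :: "'a ugraph \<Rightarrow> bool" where
  "diameter_two G \<longleftrightarrow>
     (\<forall>x \<in> verts G. \<forall>y \<in> verts G. \<exists>p. path_between G x p y \<and> length p - 1 \<le> 2)"

datatype colour = Red | Blue

text \<open>
  A colouring is a total function on vertex sets; only its values on the edges of the graph matter.
\<close>

definition monochromatic_graph :: "('a set \<Rightarrow> colour) \<Rightarrow> 'a ugraph \<Rightarrow> bool" where
  "monochromatic_graph c H \<longleftrightarrow> (\<exists>k. \<forall>e \<in> edges H. c e = k)"

definition mono_diameter_two_subgraph ::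
    "('a set \<Rightarrow> colour) \<Rightarrow> 'a ugraph \<Rightarrow> 'a ugraph \<Rightarrow> bool" where
  "mono_diameter_two_subgraph c G H \<longleftrightarrow> subgraph H G \<and> monochromatic_graph c H \<and> diameter_two H"

end

theory Submission imports Defs begin

text \<open>
  Call a vertex red-forced if it is joined by a blue edge to a vertex with which all its common red
  neighbours are already red-forced, and define blue-forced symmetrically; no vertex is both.
  If the whole graph has neither red nor blue diameter two, there are a red edge \<open>uv\<close> without common
  blue neighbour and a blue edge \<open>xy\<close> without common red neighbour. Deleting the red-forced vertices
  that are blue neighbours of \<open>v\<close> (or of \<open>u\<close>) leaves a set of red diameter two, and dually for \<open>x\<close>
  and \<open>y\<close>. The four deleted sets are disjoint, so one of them has at most \<open>n / 4\<close> elements.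

  For sharpness, split the vertices evenly into four classes and let red join consecutive classes
  \<open>0 - 1 - 2 - 3\<close>, so that blue joins the classes as \<open>2 - 0 - 3 - 1\<close>. The two end classes of either
  path cannot both be met by a subgraph of diameter two in that colour.
\<close>

section \<open>Forced vertices and the four deletions\<close>

definition diam2_on :: "('a \<Rightarrow> 'a \<Rightarrow> bool) \<Rightarrow> 'a set \<Rightarrow> bool" where
  "diam2_on r S \<longleftrightarrow> (\<forall>a\<in>S. \<forall>b\<in>S. a = b \<or> r a b \<or> (\<exists>z\<in>S. r z a \<and> r z b))"

text \<open>As a least fixed point it starts from blue edges without common red neighbour, and rule
  induction becomes available for excluding the opposite colour.\<close>

inductive forced :: "('a \<Rightarrow> 'a \<Rightarrow> bool) \<Rightarrow> ('a \<Rightarrow> 'a \<Rightarrow> bool) \<Rightarrow> 'a \<Rightarrow> bool"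
  for r s where
  forcedI: "s p q \<Longrightarrow> (\<And>z. r z p \<Longrightarrow> r z q \<Longrightarrow> forced r s z) \<Longrightarrow> forced r s q"

text \<open>Think of \<open>r\<close> as red and \<open>s\<close> as blue. With relations instead of
  a colouring, \<open>swapped\<close> yields every dual statement; \<open>r_mem\<close> and
  \<open>s_mem\<close> allow neighbours to be quantified without mentioning
  \<open>V\<close>.\<close>

locale two_coloured =
  fixes V :: "'a set" and r s :: "'a \<Rightarrow> 'a \<Rightarrow> bool"
  assumes fin: "finite V"
    and r_sym: "r a b \<Longrightarrow> r b a"
    and s_sym: "s a b \<Longrightarrow> s b a"
    and r_mem: "r a b \<Longrightarrow> a \<in> V"
    and s_mem: "s a b \<Longrightarrow> a \<in> V"
    and total: "a \<in> V \<Longrightarrow> b \<in> V \<Longrightarrow> a \<noteq> b \<Longrightarrow> r a b \<or> s a b"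
    and excl: "r a b \<Longrightarrow> \<not> s a b"
    and r_irrefl: "\<not> r a a"
    and s_irrefl: "\<not> s a a"
begin

lemma swapped: "two_coloured V s r"
  by unfold_locales (use fin r_sym s_sym r_mem s_mem total excl r_irrefl s_irrefl in blast)+

text \<open>The second conjunct says that a forced vertex is never the witness of an oppositely forced one.\<close>

lemma forced_opposite_aux:
  assumes "forced r s t"
  shows "\<not> forced s r t \<and>
    (\<forall>q. r t q \<longrightarrow> (\<forall>z. s z t \<longrightarrow> s z q \<longrightarrow> forced s r z) \<longrightarrow> \<not> forced s r q)"
  using assms
proof (induction rule: forced.induct)
  case (forcedI p t)
  note pt = \<open>s p t\<close>
  have mem: "p \<in> V" "t \<in> V" using pt s_mem s_sym by blast+
  \<comment> \<open>The second conjunct needs the witness \<open>p\<close> to be not blue-forced, so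
    a nested induction treats \<open>p\<close> along with \<open>t\<close>.\<close>
  have avoid: "x \<noteq> p \<and> x \<noteq> t" if "forced s r x" for x
    using that
  proof (induction rule: forced.induct)
    case wx: (forcedI w x)
    have fx: "forced s r x"
      using wx by (blast intro: forced.forcedI)
    \<comment> \<open>Otherwise \<open>w\<close> is a common red neighbour of \<open>p\<close> and
      \<open>t\<close>, and the outer hypothesis forbids it to be the witness for
      \<open>x\<close>.\<close>
    have not_both: "\<not> (r w p \<and> r w t)" if "x = p \<or> x = t"
      using that forcedI.IH wx(1,2) fx by blast
    have "w \<in> V" using wx(1) r_mem by blast
    then have "r w p \<or> w = p \<or> s w p" "r w t \<or> w = t \<or> s w t"
      using mem total by blast+
    \<comment> \<open>If \<open>x\<close> is one of \<open>p\<close>, \<open>t\<close>, then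
      \<open>w\<close> is blue to the other one, which is thus a common blue neighbour of
      \<open>w\<close> and \<open>x\<close>, against the inner hypothesis.\<close>
    then show ?case
      using not_both wx pt s_sym r_sym excl by metis
  qed
  have "\<not> forced s r q"
    if "r t q" and E: "\<And>z. s z t \<Longrightarrow> s z q \<Longrightarrow> forced s r z" for q
  proof
    assume fq: "forced s r q"
    have "q \<noteq> p" using that pt s_sym excl by blast
    moreover have "q \<in> V" using that r_sym r_mem by blast
    \<comment> \<open>If red, \<open>q\<close> is a common red neighbour of \<open>p\<close> and
      \<open>t\<close>; if blue, \<open>p\<close> is a common blue neighbour of \<open>t\<close> and
      \<open>q\<close>, hence blue-forced by \<open>E\<close>.\<close>
    ultimately consider "r q p" | "s q p"
      using mem total by blast
    then show False
    proof cases
      case 1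
      then show False using forcedI.IH that r_sym fq by blast
    next
      case 2
      then show False using E pt s_sym avoid by blast
    qed
  qed
  then show ?case using avoid by blast
qed

lemma not_forced_both: "\<not> (forced r s t \<and> forced s r t)"
  using forced_opposite_aux by blast

text \<open>If \<open>a\<close> and \<open>b\<close> violate the claim, all their common red
  neighbours were deleted, hence are forced. So each of \<open>a\<close>, \<open>b\<close> is forced
  with the other as witness. But \<open>v\<close> survives and must be blue to one of them, which
  should then have been deleted.\<close>

lemma diam2_on_diff_forced:
  assumes uv: "r u v" and far: "\<And>z. \<not> (s z u \<and> s z v)"
  shows "diam2_on r (V - {w. forced r s w \<and> s w v})"
  unfolding diam2_on_def
proof (intro ballI)
  fix a b
  let ?S = "V - {w. forced r s w \<and> s w v}"
  assume a: "a \<in> ?S" and b: "b \<in> ?S"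
  have memb: "u \<in> ?S" "v \<in> ?S"
    using uv r_mem r_sym s_irrefl excl by blast+
  show "a = b \<or> r a b \<or> (\<exists>z\<in>?S. r z a \<and> r z b)"
  proof (rule ccontr)
    assume none: "\<not> ?thesis"
    have through: "s w a \<or> s w b" if "w \<in> ?S" for w
      using that none a b total[of w a] total[of w b] r_sym by blast
    have split: False if "x \<in> ?S" "y \<in> ?S" "s x v" "s y x" "\<not> (\<exists>z\<in>?S. r z x \<and> r z y)"
        "s y u" for x y
    proof -
      have "forced r s x"
        using \<open>s y x\<close>
      proof (rule forced.forcedI)
        fix z assume z: "r z y" "r z x"
        then have "z \<notin> ?S" using that by blast
        then show "forced r s z" using z r_mem by blast
      qed
      then show False using that by blast
    qed
    have "s a b" using none a b total by blast
    moreover have "s v a \<or> s v b" "s u a \<or> s u b"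
      using through memb by blast+
    ultimately show False
      using split[of a b] split[of b a] a b none far s_sym by blast
  qed
qed

lemma card_diff_four:
  assumes "A1 \<subseteq> V" "A2 \<subseteq> V" "A3 \<subseteq> V" "A4 \<subseteq> V"
    and "A1 \<inter> A2 = {}" "(A1 \<union> A2) \<inter> (A3 \<union> A4) = {}" "A3 \<inter> A4 = {}"
  shows "\<exists>A\<in>{A1, A2, A3, A4}. 3 * card V \<le> 4 * card (V - A)"
proof -
  have f: "finite A1" "finite A2" "finite A3" "finite A4"
    using assms fin finite_subset by blast+
  have "card A1 + card A2 + (card A3 + card A4) = card ((A1 \<union> A2) \<union> (A3 \<union> A4))"
    using f assms by (simp add: card_Un_disjoint)
  also have "\<dots> \<le> card V"
    using assms fin by (intro card_mono) auto
  finally have "4 * card A1 \<le> card V \<or> 4 * card A2 \<le> card V \<or>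
      4 * card A3 \<le> card V \<or> 4 * card A4 \<le> card V"
    by linarith
  moreover have "3 * card V \<le> 4 * card (V - A)"
    if "A \<in> {A1, A2, A3, A4}" "4 * card A \<le> card V" for A
  proof -
    have "A \<subseteq> V" using that assms by blast
    then have "card (V - A) = card V - card A"
      using fin by (simp add: card_Diff_subset finite_subset)
    then show ?thesis using that by linarith
  qed
  ultimately show ?thesis by blast
qed

lemma not_diam2_onD:
  assumes "\<not> diam2_on r V"
  obtains x y where "s x y" "\<And>z. \<not> (r z x \<and> r z y)"
proof -
  obtain x y where "x \<in> V" "y \<in> V" "x \<noteq> y" "\<not> r x y" "\<not> (\<exists>z\<in>V. r z x \<and> r z y)"
    using assms unfolding diam2_on_def by blast
  then show ?thesis using that[of x y] total r_mem by blast
qed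

end

lemma (in two_coloured) large_diam2_on:
  "\<exists>S\<subseteq>V. 3 * card V \<le> 4 * card S \<and> (diam2_on r S \<or> diam2_on s S)"
proof (cases "diam2_on r V \<or> diam2_on s V")
  case True
  then show ?thesis by (intro exI[of _ V]) auto
next
  case False
  interpret sw: two_coloured V s r by (rule swapped)
  obtain x y where xy: "s x y" "\<And>z. \<not> (r z x \<and> r z y)"
    using False not_diam2_onD by blast
  obtain u v where uv: "r u v" "\<And>z. \<not> (s z u \<and> s z v)"
    using False sw.not_diam2_onD by blast
  let ?D = "\<lambda>v. {w. forced r s w \<and> s w v}" and ?E = "\<lambda>y. {w. forced s r w \<and> r w y}"
  have "diam2_on r (V - ?D u)" "diam2_on r (V - ?D v)"
    using diam2_on_diff_forced[of u v] diam2_on_diff_forced[of v u] uv r_sym by blast+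
  moreover have "diam2_on s (V - ?E x)" "diam2_on s (V - ?E y)"
    using sw.diam2_on_diff_forced[of x y] sw.diam2_on_diff_forced[of y x] xy s_sym by blast+
  \<comment> \<open>\<open>?D u\<close> and \<open>?D v\<close> are disjoint because
    \<open>u\<close> and \<open>v\<close> have no common blue neighbour, dually for
    \<open>?E\<close>; a \<open>?D\<close> and an \<open>?E\<close> are disjoint by
    \<open>not_forced_both\<close>.\<close>
  moreover have "\<exists>A\<in>{?D u, ?D v, ?E x, ?E y}. 3 * card V \<le> 4 * card (V - A)"
    by (rule card_diff_four) (use s_mem r_mem uv xy not_forced_both in blast)+
  ultimately show ?thesis by blast
qed

section \<open>From graphs and paths to relations\<close>

lemma simple_edge:
  assumes "simple_graph H" "{a, b} \<in> edges H"
  shows "a \<in> verts H \<and> b \<in> verts H \<and> a \<noteq> b"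
  using assms unfolding simple_graph_def by (auto simp: nsets_def card_insert_if split: if_splits)

text \<open>The three disjuncts of \<open>diam2_on\<close> are the paths with one, two and three
  vertices; simplicity supplies the distinctness that paths demand.\<close>

lemma diameter_two_iff:
  assumes "simple_graph H"
  shows "diameter_two H \<longleftrightarrow> diam2_on (\<lambda>a b. {a, b} \<in> edges H) (verts H)"
proof -
  have "(\<exists>p. path_between H a p b \<and> length p - 1 \<le> 2) \<longleftrightarrow>
      a = b \<or> {a, b} \<in> edges H \<or> (\<exists>z\<in>verts H. {z, a} \<in> edges H \<and> {z, b} \<in> edges H)"
      (is "?L \<longleftrightarrow> ?R")
    if ab: "a \<in> verts H" "b \<in> verts H" for a b
  proof
    assume ?L
    then obtain p where p: "path_between H a p b" "length p \<le> 3" by auto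
    then consider z where "p = [z]" | z w where "p = [z, w]" | z w t where "p = [z, w, t]"
      by (auto simp: path_between_def numeral_3_eq_3 le_Suc_eq length_Suc_conv)
    then show ?R
      using p by cases (auto simp: path_between_def insert_commute)
  next
    assume ?R
    show ?L
    proof (cases "a = b \<or> {a, b} \<in> edges H")
      case True
      then have "path_between H a [a] b \<or> path_between H a [a, b] b"
        using ab simple_edge[OF assms] by (auto simp: path_between_def)
      then show ?thesis by (elim disjE) (rule exI, erule conjI, simp)+
    next
      case False
      then obtain z where "z \<in> verts H" "{z, a} \<in> edges H" "{z, b} \<in> edges H"
        using \<open>?R\<close> by blast
      then have "path_between H a [a, z, b] b"
        using ab False simple_edge[OF assms] by (auto simp: path_between_def insert_commute)
      then show ?thesis by (intro exI[of _ "[a, z, b]"]) simp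
    qed
  qed
  then show ?thesis unfolding diameter_two_def diam2_on_def by blast
qed

lemma ceiling_three_quarters_le_iff: "\<lceil>3 * real n / 4\<rceil> \<le> int m \<longleftrightarrow> 3 * n \<le> 4 * m"
  by (simp add: ceiling_le_iff) linarith

lemma mono_diameter_two_subgraph_exists:
  "\<exists>H. mono_diameter_two_subgraph c (complete_graph n) H \<and>
     int (card (verts H)) \<ge> \<lceil>3 * real n / 4\<rceil>"
proof -
  define rel where "rel k a b \<longleftrightarrow> {a, b} \<in> [{..<n}]\<^bsup>2\<^esup> \<and> c {a, b} = k" for k a b
  have "two_coloured {..<n} (rel Red) (rel Blue)"
  proof
    show "rel Red a b \<or> rel Blue a b" if "a \<in> {..<n}" "b \<in> {..<n}" "a \<noteq> b" for a b
      using that by (cases "c {a, b}") (auto simp: rel_def)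
  qed (auto simp: rel_def insert_commute, simp_all add: nsets_def)
  from two_coloured.large_diam2_on[OF this]
  obtain S k where S: "S \<subseteq> {..<n}" "3 * n \<le> 4 * card S" "diam2_on (rel k) S"
    by auto
  \<comment> \<open>All edges of colour \<open>k\<close> inside \<open>S\<close> are taken, so that
    no connection in \<open>rel k\<close> is lost.\<close>
  define H where "H = \<lparr>verts = S, edges = {e \<in> [S]\<^bsup>2\<^esup>. c e = k}\<rparr>"
  have simple: "simple_graph H" by (auto simp: H_def simple_graph_def)
  have "rel k a b \<Longrightarrow> a \<in> S \<Longrightarrow> b \<in> S \<Longrightarrow> {a, b} \<in> edges H" for a b
    by (auto simp: rel_def H_def nsets_def)
  then have "diameter_two H"
    using S(3) unfolding diameter_two_iff[OF simple] diam2_on_def by (simp add: H_def) blast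
  moreover have "subgraph H (complete_graph n)"
    using simple S(1) by (auto simp: subgraph_def complete_graph_def H_def nsets_def)
  moreover have "monochromatic_graph c H"
    by (auto simp: monochromatic_graph_def H_def)
  ultimately show ?thesis
    using S(2) unfolding mono_diameter_two_subgraph_def ceiling_three_quarters_le_iff
    by (intro exI[of _ H]) (simp add: H_def)
qed

section \<open>Sharpness\<close>

definition class_colouring :: "nat set \<Rightarrow> colour" where
  "class_colouring e = (if \<forall>a\<in>e. \<forall>b\<in>e. a mod 4 \<le> Suc (b mod 4) then Red else Blue)"

text \<open>Bounding both ways, residues modulo 4 differ by at most 1 on red edges; in particular
  edges inside a class are red.\<close>

lemma class_colouring_pair:
  "class_colouring {a, b} = Red \<longleftrightarrow> a mod 4 \<le> Suc (b mod 4) \<and> b mod 4 \<le> Suc (a mod 4)"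
  by (auto simp: class_colouring_def)

lemma div_4_le_card_class:
  assumes "j < 4"
  shows "n div 4 \<le> card {i. i < n \<and> i mod 4 = j}"
proof -
  have "(\<lambda>q. 4 * q + j) ` {..<n div 4} \<subseteq> {i. i < n \<and> i mod 4 = j}"
    using assms by auto
  then have "card ((\<lambda>q. 4 * q + j) ` {..<n div 4}) \<le> card {i. i < n \<and> i mod 4 = j}"
    by (intro card_mono) auto
  then show ?thesis by (simp add: card_image inj_on_def)
qed

lemma class_colouring_misses_class:
  assumes "mono_diameter_two_subgraph class_colouring (complete_graph n) H"
  shows "\<exists>j<4. \<forall>a\<in>verts H. a mod 4 \<noteq> j"
proof (rule ccontr)
  assume none: "\<not> ?thesis"
  have simple: "simple_graph H"
    and diam: "diam2_on (\<lambda>a b. {a, b} \<in> edges H) (verts H)"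
    and "monochromatic_graph class_colouring H"
    using assms diameter_two_iff
    by (auto simp: mono_diameter_two_subgraph_def subgraph_def)
  then obtain k where k: "\<And>e. e \<in> edges H \<Longrightarrow> class_colouring e = k"
    unfolding monochromatic_graph_def by blast
  \<comment> \<open>The end classes of the path of colour \<open>k\<close>: 0 and 3 for red, 1 and 2
    for blue.\<close>
  define i j where "i = (if k = Red then 0 else 1 :: nat)" and "j = (if k = Red then 3 else 2 :: nat)"
  have "i < 4" "j < 4" by (auto simp: i_def j_def)
  then obtain a b where ab: "a \<in> verts H" "b \<in> verts H" "a mod 4 = i" "b mod 4 = j"
    using none by blast
  have "a \<noteq> b" using ab by (auto simp: i_def j_def split: if_splits)
  have col: "class_colouring {x, y} = Red \<longleftrightarrow> k = Red" if "{x, y} \<in> edges H" for x y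
    using k[OF that] by simp
  have "{a, b} \<notin> edges H"
    using col[of a b] ab by (auto simp: class_colouring_pair i_def j_def split: if_splits)
  then obtain z where "{z, a} \<in> edges H" "{z, b} \<in> edges H"
    using diam ab \<open>a \<noteq> b\<close> unfolding diam2_on_def by blast
  \<comment> \<open>In red, class 0 sees only 0 and 1, class 3 only 2 and 3; in blue, class 1 sees
    only 3, class 2 only 0. No class fits \<open>z\<close>.\<close>
  then show False
    using col[of z a] col[of z b] ab mod_less_divisor[of 4 z]
    by (auto simp: class_colouring_pair i_def j_def split: if_splits)
qed

lemma class_colouring_upper_bound:
  assumes "mono_diameter_two_subgraph class_colouring (complete_graph n) H"
  shows "card (verts H) \<le> n - n div 4"
proof -
  obtain j where j: "j < 4" "\<forall>a\<in>verts H. a mod 4 \<noteq> j"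
    using class_colouring_misses_class[OF assms] by blast
  let ?C = "{i. i < n \<and> i mod 4 = j}"
  have "verts H \<subseteq> {..<n} - ?C"
    using assms j by (auto simp: mono_diameter_two_subgraph_def subgraph_def complete_graph_def)
  then have "card (verts H) \<le> card ({..<n} - ?C)"
    by (intro card_mono) auto
  also have "\<dots> = n - card ?C"
    by (subst card_Diff_subset) auto
  also have "\<dots> \<le> n - n div 4"
    using div_4_le_card_class[OF j(1)] by (rule diff_le_mono2)
  finally show ?thesis .
qed

theorem theorem1:
  fixes n :: nat
  assumes "n \<ge> 1"
  shows "(\<forall>c :: nat set \<Rightarrow> colour. \<exists>H.
            mono_diameter_two_subgraph c (complete_graph n) H \<and>
            int (card (verts H)) \<ge> \<lceil>3 * real n / 4\<rceil>) \<and>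
         (\<exists>c :: nat set \<Rightarrow> colour. \<exists>H.
            is_arg_max (\<lambda>H. card (verts H)) (mono_diameter_two_subgraph c (complete_graph n)) H \<and>
            int (card (verts H)) = \<lceil>3 * real n / 4\<rceil>)"
proof
  show "\<forall>c. \<exists>H. mono_diameter_two_subgraph c (complete_graph n) H \<and>
      int (card (verts H)) \<ge> \<lceil>3 * real n / 4\<rceil>"
    using mono_diameter_two_subgraph_exists by blast
  let ?P = "mono_diameter_two_subgraph class_colouring (complete_graph n)"
  obtain H where H: "?P H" "\<lceil>3 * real n / 4\<rceil> \<le> int (card (verts H))"
    using mono_diameter_two_subgraph_exists by blast
  have ceil: "\<lceil>3 * real n / 4\<rceil> = int (n - n div 4)"
  proof -
    \<comment> \<open>Both integers have the same upper bounds among the naturals. Being natural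
      numbers themselves, they can be inserted for \<open>m\<close>, which makes them equal.\<close>
    have "3 * n \<le> 4 * m \<longleftrightarrow> n - n div 4 \<le> m" for m by linarith
    then have "\<lceil>3 * real n / 4\<rceil> \<le> int m \<longleftrightarrow> int (n - n div 4) \<le> int m" for m
      by (simp only: ceiling_three_quarters_le_iff of_nat_le_iff)
    moreover have "\<lceil>3 * real n / 4\<rceil> = int (nat \<lceil>3 * real n / 4\<rceil>)" by simp
    ultimately show ?thesis by (metis order.refl order.antisym)
  qed
  have "card (verts H') \<le> n - n div 4" if "?P H'" for H'
    using that by (rule class_colouring_upper_bound)
  then have "is_arg_max (\<lambda>H. card (verts H)) ?P H \<and> int (card (verts H)) = \<lceil>3 * real n / 4\<rceil>"
    using H ceil by (fastforce simp: is_arg_max_def)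
  then show "\<exists>c H. is_arg_max (\<lambda>H. card (verts H))
        (mono_diameter_two_subgraph c (complete_graph n)) H \<and>
      int (card (verts H)) = \<lceil>3 * real n / 4\<rceil>"
    by blast
qed

end
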